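(* Let $n,m\ge 1$, $x_0\in\mathbb{R}^n$ and $r>0$. Let $F:D^n_r(x_0)\to\mathbb{R}^m$ be a continuous map such that $F(x)\neq 0$ for every $x\in S^{n-1}_r(x_0)$, and let $F_\mid:S^{n-1}_r(x_0)\to\mathbb{R}^m\setminus\{0\}$, $F_\mid(x)=F(x)$, be the restriction. If $\mathrm{cat}(F_\mid)=2$, then the equation $F(x)=0$ has a solution $x\in D^n_r(x_0)$.
   Context: $D^n_r(x_0)=\{x\in\mathbb{R}^n:\|x-x_0\|\le r\}$ and $S^{n-1}_r(x_0)=\{x\in\mathbb{R}^n:\|x-x_0\|=r\}$. A continuous map $f:X\to Y$ of topological spaces is null-homotopic if it is homotopic to a constant map $X\to Y$, $x\mapsto y_0$, for some $y_0\in Y$ (homotopies are free, without base points). The category $\mathrm{cat}(f)$ of a continuous map $f:X\to Y$ is the least positive integer $k$ such that there are open subsets $U_1,\dots,U_k$ of $X$ with $X=U_1\cup\cdots\cup U_k$ and each restriction $f_{|U_i}:U_i\to Y$ null-homotopic; $\mathrm{cat}(f)=\infty$ if no such integer exists. *)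

theory Defs
  imports "HOL-Analysis.Analysis" "HOL-Library.Extended_Nat"
begin

definition null_homotopic :: "'a topology \<Rightarrow> 'b topology \<Rightarrow> ('a \<Rightarrow> 'b) \<Rightarrow> bool" where
  "null_homotopic X Y f \<longleftrightarrow>
     (\<exists>y0\<in>topspace Y. homotopic_with (\<lambda>_. True) X Y f (\<lambda>_. y0))"

definition cat_cover ::
    "'a topology \<Rightarrow> 'b topology \<Rightarrow> ('a \<Rightarrow> 'b) \<Rightarrow> nat \<Rightarrow> bool" where
  "cat_cover X Y f k \<longleftrightarrow>
     (\<exists>U :: nat \<Rightarrow> 'a set.
        (\<forall>i\<in>{1..k}. openin X (U i)) \<and>
        topspace X = (\<Union>i\<in>{1..k}. U i) \<and>
        (\<forall>i\<in>{1..k}. null_homotopic (subtopology X (U i)) Y f))"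

text \<open>The infimum is taken in \<^typ>\<open>enat\<close>, so it is attained when the set is nonempty,
  and it is \<open>\<infinity>\<close> when the set is empty.\<close>

definition map_cat :: "'a topology \<Rightarrow> 'b topology \<Rightarrow> ('a \<Rightarrow> 'b) \<Rightarrow> enat" where
  "map_cat X Y f = Inf {enat k | k. 1 \<le> k \<and> cat_cover X Y f k}"

end

theory Submission
  imports Defs
begin

text \<open>If \<open>F\<close> had no zero, it would map the contractible ball into the complement of the origin, so
  its restriction to the sphere would be null-homotopic and hence of category 1.\<close>

text \<open>The whole space is by itself an admissible open cover with one member.\<close>

lemma map_cat_le_1_if_null_homotopic:
  assumes "null_homotopic X Y f"
  shows "map_cat X Y f \<le> 1"
proof -
  have "cat_cover X Y f 1"
    unfolding cat_cover_def using assms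
    by (intro exI[of _ "\<lambda>_. topspace X"]) (simp add: subtopology_topspace)
  then show ?thesis
    unfolding map_cat_def by (intro Inf_lower) (auto simp: one_enat_def)
qed

text \<open>A contraction of \<open>S\<close> deforms \<open>f\<close> to a constant, and this
  homotopy restricts to \<open>A\<close>, which need not be contractible itself: in the application
  it is a sphere.\<close>

lemma null_homotopic_on_subset_of_contractible:
  fixes f :: "'a::real_normed_vector \<Rightarrow> 'b::real_normed_vector"
  assumes "continuous_on S f" "f \<in> S \<rightarrow> T" "contractible S" "S \<noteq> {}" "A \<subseteq> S"
  shows "null_homotopic (top_of_set A) (top_of_set T) f"
proof -
  obtain c where c: "homotopic_with_canon (\<lambda>_. True) S T f (\<lambda>_. c)"
    using nullhomotopic_from_contractible assms(1-3) by blast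
  \<comment> \<open>A point of \<open>S\<close> is needed to force \<open>c\<close> into
    \<open>T\<close>: over an empty \<open>S\<close> the constant could be arbitrary.\<close>
  have "c \<in> T"
    using homotopic_with_imp_subset2[OF c] \<open>S \<noteq> {}\<close> by auto
  with homotopic_with_subset_left[OF c \<open>A \<subseteq> S\<close>] show ?thesis
    unfolding null_homotopic_def by auto
qed

theorem mainTheorem3:
  fixes F :: "real ^ 'n \<Rightarrow> real ^ 'm" and x0 :: "real ^ 'n" and r :: real
  assumes "r > 0"
    and "continuous_on (cball x0 r) F"
    and "\<forall>x\<in>sphere x0 r. F x \<noteq> 0"
    and "map_cat (top_of_set (sphere x0 r)) (top_of_set (UNIV - {0})) F = 2"
  shows "\<exists>x\<in>cball x0 r. F x = 0"
proof (rule ccontr)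
  assume "\<not> (\<exists>x\<in>cball x0 r. F x = 0)"
  then have "null_homotopic (top_of_set (sphere x0 r)) (top_of_set (UNIV - {0})) F"
    \<comment> \<open>\<open>r > 0\<close> makes the ball nonempty, and the absence of zeros lets
      \<open>F\<close> map all of it into \<open>UNIV - {0}\<close>.\<close>
    using assms(1,2) convex_imp_contractible[OF convex_cball, of x0 r]
    by (intro null_homotopic_on_subset_of_contractible[of "cball x0 r"]) auto
  from map_cat_le_1_if_null_homotopic[OF this] assms(4) show False
    by (simp add: one_enat_def numeral_eq_enat)
qed

end
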